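(* Let $\alpha_2,\beta_2,\delta_2\in\mathbb{R}$ and define, for $x\in\left(0,\frac{\pi}{2}\right]$, $$f_2(x)=\left(1-\frac{4(\pi-2)}{\pi^3}x^2\right)^{\alpha_2x^3+\beta_2x^2+\delta_2}-\frac{\sin x}{x}.$$ Suppose that $$f_2(0+)=f_2'(0+)=f_2''(0+)=0,\qquad f_2\left(\tfrac{\pi}{2}\right)=f_2'\left(\tfrac{\pi}{2}\right)=0.$$ Then $$\alpha_2=-\frac{2}{3}\cdot\frac{12(\pi-2)(\pi-3)-(48-24\pi+\pi^3)\ln\frac{\pi}{2}}{\pi^3(\pi-2)\ln\frac{\pi}{2}},$$ $$\beta_2=\frac{8(\pi-2)(\pi-3)-(48-24\pi+\pi^3)\ln\frac{\pi}{2}}{2\pi^2(\pi-2)\ln\frac{\pi}{2}},$$ $$\delta_2=\frac{\pi^3}{24(\pi-2)},$$ and $f_2(x)<0$ for every $x\in\left(0,\frac{\pi}{2}\right)$.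
   Context: For a function $g$ defined to the right of $0$, $g(0+)=\lim_{x\to0^+}g(x)$; in particular $f'(0+)$ and $f''(0+)$ denote the right-hand limits at $0$ of the first and second derivatives. The derivative at $x=\pi/2$ is the (left) derivative there, equivalently the derivative of the given formula, which is smooth in a neighbourhood of $\pi/2$. The base $1-\frac{4(\pi-2)}{\pi^3}x^2$ is positive on $\left(0,\frac{\pi}{2}\right]$, so the real power is well defined. *)

theory Defs
  imports "HOL-Analysis.Analysis"
begin

(* Only the values for 0 < x \<le> pi/2 are meaningful. There the base of the power is positive,
   so powr is the genuine real power; in particular the value at x = 0 is a junk value
   (sin 0 / 0 = 0). *)
definition f2 :: "real \<Rightarrow> real \<Rightarrow> real \<Rightarrow> real \<Rightarrow> real" where
  "f2 \<alpha> \<beta> \<delta> x =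
     (1 - 4 * (pi - 2) / pi ^ 3 * x\<^sup>2) powr (\<alpha> * x ^ 3 + \<beta> * x\<^sup>2 + \<delta>) - sin x / x"

end

theory Submission
  imports Defs "HOL-Real_Asymp.Real_Asymp"
begin

text \<open>
  Write \<open>\<kappa> = 4 (\<pi> - 2) / \<pi>\<^sup>3\<close>, let \<open>p\<close> be the cubic in the exponent, and put
  \<open>R x = ln (sin x / x) / ln (1 - \<kappa> x\<^sup>2)\<close>. Since \<open>ln (1 - \<kappa> x\<^sup>2) < 0\<close>, the claim \<open>f\<^sub>2 x < 0\<close>
  says exactly \<open>R x < p x\<close>. The five hypotheses make \<open>p\<close> the Hermite interpolant of the even
  function \<open>R\<close>: the conditions at \<open>0\<close> give \<open>\<delta> = R (0+) = 1 / (6 \<kappa>)\<close>, while \<open>p\<close> has no linear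
  term by its shape, and those at \<open>\<pi> / 2\<close> fix value and slope there. The last two are linear
  equations for \<open>\<alpha>\<close> and \<open>\<beta>\<close>.

  For the sign, consider \<open>W x = (p x - R x) / x\<^sup>2 = \<beta> + \<alpha> x + (\<delta> - R x) / x\<^sup>2\<close>, which has a
  double zero at \<open>\<pi> / 2\<close>. If \<open>(\<delta> - R x) / x\<^sup>2\<close> is strongly convex, then \<open>W\<close> lies strictly
  above its tangent at \<open>\<pi> / 2\<close>, that is, \<open>W > 0\<close> elsewhere.

  The convexity comes from signs of Taylor coefficients. The product formula for the sine
  splits \<open>R\<close> into the quotients \<open>ln (1 - t v) / ln (1 - v)\<close> with \<open>v = \<kappa> x\<^sup>2\<close> and
  \<open>t = 1 / (\<pi>\<^sup>2 m\<^sup>2 \<kappa>)\<close>, and \<open>\<delta>\<close> is the sum of the values \<open>t\<close> of these quotients at \<open>0\<close>. The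
  numerical fact \<open>3 \<pi> > 8\<close> gives \<open>t < 1\<close>. An argument of Kaluza type
  (\<open>fps_quotient_coeffs_neg\<close>) shows that all coefficients of such a quotient beyond the
  constant one are negative. So \<open>(\<delta> - R x) / x\<^sup>2\<close> is a sum of power series in \<open>x\<^sup>2\<close> with
  positive coefficients (\<open>convex_ln_sinc_quotient\<close>).
\<close>

section \<open>Quotients of power series\<close>

lemma fps_quotient_convolution:
  fixes a b :: "nat \<Rightarrow> real"
  assumes "b 0 \<noteq> 0"
  shows "(\<Sum>j\<le>m. fps_nth (Abs_fps a / Abs_fps b) j * b (m - j)) = a m"
proof -
  have "fps_nth (Abs_fps b) 0 \<noteq> 0"
    using assms by simp
  then have "Abs_fps a / Abs_fps b * Abs_fps b = Abs_fps a"
    by (metis dvd_div_mult_self fps_unit_dvd)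
  then have "fps_nth (Abs_fps a / Abs_fps b * Abs_fps b) m = a m"
    by simp
  then show ?thesis
    by (simp add: fps_mult_nth atMost_atLeast0)
qed

text \<open>Kaluza's argument. Let \<open>r\<close> be the quotient and subtract \<open>b (n + 1) / b n\<close> times the
  convolution identity for \<open>a n\<close> from the one for \<open>a (n + 1)\<close>. The contribution of \<open>r 0\<close>
  cancels; that of each earlier negative coefficient is nonnegative, because the ratios
  \<open>b (i + 1) / b i\<close> do not decrease; what is left is the term \<open>r (n + 1) b 0\<close>, bounded by
  \<open>a (n + 1) - b (n + 1) / b n * a n < 0\<close>.\<close>

lemma fps_quotient_coeffs_neg:
  fixes a b :: "nat \<Rightarrow> real"
  assumes b_pos: "\<And>n. 0 < b n"
    and b_ratio: "\<And>i n. i \<le> n \<Longrightarrow> b (Suc i) * b n \<le> b (Suc n) * b i"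
    and a_ratio: "\<And>n. a (Suc n) * b n < b (Suc n) * a n"
  defines "r \<equiv> Abs_fps a / Abs_fps b"
  shows "fps_nth r (Suc n) < 0"
proof (induction n rule: less_induct)
  case (less n)
  have conv: "a m = (\<Sum>j\<le>m. fps_nth r j * b (m - j))" for m
    using fps_quotient_convolution[of b a m] b_pos[of 0] by (simp add: r_def)
  \<comment> \<open>This multiplier removes the term with index \<open>0\<close> from the difference below.\<close>
  let ?l = "b (Suc n) / b n"
  have eq: "a (Suc n) - ?l * a n =
      (\<Sum>j\<le>n. fps_nth r j * (b (Suc n - j) - ?l * b (n - j))) + fps_nth r (Suc n) * b 0"
    by (simp add: conv sum_distrib_left sum_subtractf algebra_simps)
  have "0 \<le> (\<Sum>j\<le>n. fps_nth r j * (b (Suc n - j) - ?l * b (n - j)))"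
  proof (rule sum_nonneg)
    fix j assume j: "j \<in> {..n}"
    show "0 \<le> fps_nth r j * (b (Suc n - j) - ?l * b (n - j))"
    proof (cases j)
      case 0
      then show ?thesis using b_pos[of n] by simp
    next
      case (Suc i)
      have "fps_nth r j < 0"
        using less[of i] Suc j by simp
      moreover have "b (Suc n - j) \<le> ?l * b (n - j)"
        using b_ratio[of "n - j" n] b_pos[of n] j by (simp add: Suc_diff_le field_simps)
      ultimately show ?thesis
        by (simp add: mult_nonpos_nonpos)
    qed
  qed
  with eq have "fps_nth r (Suc n) * b 0 \<le> a (Suc n) - ?l * a n"
    by linarith
  also have "\<dots> < 0"
    using a_ratio[of n] b_pos[of n] by (simp add: field_simps)
  finally show ?case
    using b_pos[of 0] by (simp add: mult_less_0_iff)
qed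

text \<open>Once the signs are known they also control the size, and hence the convergence, of the
  quotient series: in the convolution identity for \<open>a n \<ge> 0\<close> only the term with \<open>r 0\<close> can
  balance the negative term \<open>r n * b 0\<close>.\<close>

lemma fps_quotient_coeffs_bound:
  fixes a b :: "nat \<Rightarrow> real"
  assumes b_pos: "\<And>n. 0 < b n"
    and a_nonneg: "\<And>n. 0 \<le> a n"
    and neg: "\<And>n. fps_nth (Abs_fps a / Abs_fps b) (Suc n) < 0"
  shows "\<bar>fps_nth (Abs_fps a / Abs_fps b) n\<bar> * b 0 \<le> fps_nth (Abs_fps a / Abs_fps b) 0 * b n"
proof -
  let ?r = "fps_nth (Abs_fps a / Abs_fps b)"
  have conv: "(\<Sum>j\<le>m. ?r j * b (m - j)) = a m" for m
    using fps_quotient_convolution[of b a m] b_pos[of 0] by simp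
  show ?thesis
  proof (cases n)
    case 0
    then show ?thesis
      using conv[of 0] a_nonneg[of 0] b_pos[of 0] by (simp add: abs_mult zero_le_mult_iff)
  next
    case (Suc m)
    have "(\<Sum>j\<le>n. ?r j * b (n - j)) =
        ?r 0 * b n + (\<Sum>j<m. ?r (Suc j) * b (n - Suc j)) + ?r n * b 0"
      by (simp add: Suc sum.atMost_shift lessThan_Suc del: sum.atMost_Suc)
    then have "a n = ?r 0 * b n + (\<Sum>j<m. ?r (Suc j) * b (n - Suc j)) + ?r n * b 0"
      by (simp only: conv)
    moreover have "(\<Sum>j<m. ?r (Suc j) * b (n - Suc j)) \<le> 0"
      by (intro sum_nonpos mult_nonpos_nonneg less_imp_le neg b_pos)
    ultimately have "0 \<le> ?r 0 * b n + ?r n * b 0"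
      using a_nonneg[of n] by linarith
    then show ?thesis
      using neg[of m] Suc by simp
  qed
qed

section \<open>Quotients of logarithms\<close>

lemma ln_one_minus_sums:
  fixes t v :: real
  assumes "0 < t" "t \<le> 1" "0 < v" "v < 1"
  shows "(\<lambda>n. t ^ Suc n / real (Suc n) * v ^ n) sums (- ln (1 - t * v) / v)"
proof -
  have "t * v < 1"
    using assms mult_le_one[of t v] by (smt (verit) mult_left_le_one_le)
  then have "\<bar>- (t * v)\<bar> < 1"
    using assms by simp
  from ln_series'[OF this] have "(\<lambda>n. (t * v) ^ n / real n) sums - ln (1 - t * v)"
    using sums_minus by fastforce
  then have "(\<lambda>n. (t * v) ^ Suc n / real (Suc n)) sums - ln (1 - t * v)"
    by (subst sums_Suc_iff) simp
  from sums_divide[OF this, of v]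
  have "(\<lambda>n. (t * v) ^ Suc n / real (Suc n) / v) sums (- ln (1 - t * v) / v)" .
  also have "(\<lambda>n. (t * v) ^ Suc n / real (Suc n) / v) = (\<lambda>n. t ^ Suc n / real (Suc n) * v ^ n)"
    using assms by (auto simp: power_mult_distrib fun_eq_iff)
  finally show ?thesis .
qed

text \<open>Dividing both logarithms by \<open>- v\<close> gives series with coefficients \<open>t ^ (n + 1) / (n + 1)\<close>
  and \<open>1 / (n + 1)\<close>. The ratios of the latter increase, and the former grow more slowly since
  \<open>t < 1\<close>, so the quotient is \<open>t\<close> minus a series with positive coefficients.\<close>

lemma ln_quotient_expansion:
  fixes t :: real
  assumes t: "0 < t" "t < 1"
  shows "\<exists>c. (\<forall>n. 0 < c n) \<and>
    (\<forall>v\<in>{0<..<1}. (\<lambda>n. c n * v ^ n) sums ((t - ln (1 - t * v) / ln (1 - v)) / v))"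
proof -
  define a where "a n = t ^ Suc n / real (Suc n)" for n
  define b where "b n = 1 / real (Suc n)" for n
  define r where "r = fps_nth (Abs_fps a / Abs_fps b)"
  have b_pos: "0 < b n" and a_pos: "0 < a n" for n
    using t by (simp_all add: a_def b_def)
  have neg: "r (Suc n) < 0" for n
    unfolding r_def
  proof (rule fps_quotient_coeffs_neg)
    show "b (Suc i) * b n \<le> b (Suc n) * b i" if "i \<le> n" for i n
    proof -
      have "real (Suc (Suc n)) * real (Suc i) \<le> real (Suc (Suc i)) * real (Suc n)"
        using that by (simp add: algebra_simps)
      then have "1 / (real (Suc (Suc i)) * real (Suc n)) \<le> 1 / (real (Suc (Suc n)) * real (Suc i))"
        by (intro divide_left_mono) auto
      then show ?thesis by (simp add: b_def)
    qed
    show "a (Suc n) * b n < b (Suc n) * a n" for n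
      using t by (simp add: a_def b_def divide_strict_right_mono)
  qed (rule b_pos)
  have r0: "r 0 = t"
    using fps_quotient_convolution[of b a 0] by (simp add: a_def b_def r_def)
  have r_bound: "\<bar>r n\<bar> \<le> 1" for n
  proof -
    have "\<bar>r n\<bar> * b 0 \<le> r 0 * b n"
      unfolding r_def
      by (rule fps_quotient_coeffs_bound[OF b_pos less_imp_le[OF a_pos] neg[unfolded r_def]])
    also have "\<dots> \<le> 1 * 1"
      using t r0 by (intro mult_mono) (auto simp: b_def)
    finally show ?thesis by (simp add: b_def)
  qed
  have expansion: "(\<lambda>n. - r (Suc n) * v ^ n) sums ((t - ln (1 - t * v) / ln (1 - v)) / v)"
    if v: "0 < v" "v < 1" for v
  proof -
    have A: "(\<lambda>n. a n * v ^ n) sums (- ln (1 - t * v) / v)"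
      using ln_one_minus_sums[of t v] t v by (simp add: a_def)
    have B: "(\<lambda>n. b n * v ^ n) sums (- ln (1 - v) / v)"
      using ln_one_minus_sums[of 1 v] v by (simp add: b_def)
    have sr: "summable (\<lambda>n. norm (r n * v ^ n))"
    proof (rule summable_comparison_test'[OF summable_geometric[of v]])
      show "norm v < 1"
        using v by simp
      show "norm (norm (r n * v ^ n)) \<le> v ^ n" if "0 \<le> n" for n
        using mult_right_mono[OF r_bound[of n], of "v ^ n"] v by (simp add: abs_mult)
    qed
    have "norm (b n * v ^ n) = b n * v ^ n" for n
      using v b_pos[of n] by simp
    with sums_summable[OF B] have sb: "summable (\<lambda>n. norm (b n * v ^ n))"
      by simp
    have "(\<lambda>n. \<Sum>i\<le>n. (r i * v ^ i) * (b (n - i) * v ^ (n - i)))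
        sums ((\<Sum>n. r n * v ^ n) * (\<Sum>n. b n * v ^ n))"
      by (rule Cauchy_product_sums[OF sr sb])
    also have "(\<lambda>n. \<Sum>i\<le>n. (r i * v ^ i) * (b (n - i) * v ^ (n - i))) = (\<lambda>n. a n * v ^ n)"
    proof
      fix n
      have "(r i * v ^ i) * (b (n - i) * v ^ (n - i)) = r i * b (n - i) * v ^ n" if "i \<le> n" for i
      proof -
        have "v ^ i * v ^ (n - i) = v ^ n"
          using that by (simp flip: power_add)
        then have "(r i * b (n - i)) * (v ^ i * v ^ (n - i)) = r i * b (n - i) * v ^ n"
          by simp
        then show ?thesis by (simp only: mult_ac)
      qed
      then have "(\<Sum>i\<le>n. (r i * v ^ i) * (b (n - i) * v ^ (n - i))) = (\<Sum>i\<le>n. r i * b (n - i) * v ^ n)"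
        by (intro sum.cong) simp_all
      then show "(\<Sum>i\<le>n. (r i * v ^ i) * (b (n - i) * v ^ (n - i))) = a n * v ^ n"
        using fps_quotient_convolution[of b a n] b_pos[of 0]
        by (simp add: r_def flip: sum_distrib_right)
    qed
    finally have "(\<Sum>n. r n * v ^ n) * (- ln (1 - v) / v) = - ln (1 - t * v) / v"
      unfolding sums_unique[OF B, symmetric] by (rule sums_unique2[OF _ A])
    moreover have "ln (1 - v) < 0"
      using v by simp
    ultimately have "(\<Sum>n. r n * v ^ n) = ln (1 - t * v) / ln (1 - v)"
      using v by (simp add: field_simps)
    then have "(\<lambda>n. r n * v ^ n) sums (ln (1 - t * v) / ln (1 - v))"
      using summable_sums[OF summable_norm_cancel[OF sr]] by simp
    then have "(\<lambda>n. r (Suc n) * v ^ Suc n) sums (ln (1 - t * v) / ln (1 - v) - t)"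
      by (subst sums_Suc_iff) (simp add: r0)
    from sums_divide[OF sums_minus[OF this], of v] show ?thesis
      using v by simp
  qed
  show ?thesis
  proof (intro exI conjI allI ballI)
    show "0 < - r (Suc n)" for n
      using neg[of n] by simp
    show "(\<lambda>n. - r (Suc n) * v ^ n) sums ((t - ln (1 - t * v) / ln (1 - v)) / v)"
      if "v \<in> {0<..<1}" for v
      using that by (intro expansion) auto
  qed
qed

section \<open>Convexity\<close>

lemma convex_on_pointwise_limit:
  fixes f :: "nat \<Rightarrow> 'a::real_vector \<Rightarrow> real"
  assumes conv: "\<And>n. convex_on A (f n)"
    and lim: "\<And>x. x \<in> A \<Longrightarrow> (\<lambda>n. f n x) \<longlonglongrightarrow> g x"
  shows "convex_on A g"
proof -
  have A: "convex A"
    using conv[of 0] by (rule convex_on_imp_convex)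
  show ?thesis
    unfolding convex_on_def
  proof (intro conjI ballI allI impI A)
    fix x y and u v :: real
    assume *: "x \<in> A" "y \<in> A" "0 \<le> u" "0 \<le> v" "u + v = 1"
    then have "u *\<^sub>R x + v *\<^sub>R y \<in> A"
      using A by (simp add: convexD)
    then show "g (u *\<^sub>R x + v *\<^sub>R y) \<le> u * g x + v * g y"
    proof (rule LIMSEQ_le[OF lim])
      show "(\<lambda>n. u * f n x + v * f n y) \<longlonglongrightarrow> u * g x + v * g y"
        using * by (intro tendsto_intros lim)
      show "\<exists>N. \<forall>n\<ge>N. f n (u *\<^sub>R x + v *\<^sub>R y) \<le> u * f n x + v * f n y"
        using conv * by (auto simp: convex_on_def)
    qed
  qed
qed

lemma convex_on_even_power_series:
  fixes f :: "real \<Rightarrow> real"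
  assumes A: "convex A"
    and nonneg: "\<And>n. 0 \<le> c n"
    and sums: "\<And>x. x \<in> A \<Longrightarrow> (\<lambda>n. c n * x ^ (2 * n)) sums f x"
  shows "convex_on A f"
proof (rule convex_on_pointwise_limit)
  show "convex_on A (\<lambda>x. \<Sum>n<N. c n * x ^ (2 * n))" for N
  proof (induction N)
    case 0
    then show ?case using A by (simp add: convex_on_const)
  next
    case (Suc N)
    have "convex_on A (\<lambda>x. x ^ (2 * N))"
      by (rule convex_on_subset[OF convex_power_even]) (use A in auto)
    then show ?case
      using Suc nonneg by (simp add: convex_on_add convex_on_cmul)
  qed
  show "(\<lambda>N. \<Sum>n<N. c n * x ^ (2 * n)) \<longlonglongrightarrow> f x" if "x \<in> A" for x
    using sums[OF that] by (simp add: sums_def)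
qed

lemma mult_square_in_unit_interval:
  fixes k x :: real
  assumes k: "0 < k" and "x \<in> {0<..<1 / sqrt k}"
  shows "k * x\<^sup>2 \<in> {0<..<1}"
proof -
  have x: "0 < x" "x * sqrt k < 1"
    using assms by (auto simp: field_simps)
  then have "(x * sqrt k)\<^sup>2 < 1"
    using k by (intro power_less_one_iff[THEN iffD2]) auto
  then show ?thesis
    using k x by (simp add: power_mult_distrib mult.commute)
qed

text \<open>In \<open>v = k x\<^sup>2\<close> the series of \<open>ln_quotient_expansion\<close> contains only even powers of \<open>x\<close>, all
  with positive coefficients. The one of \<open>x\<^sup>2\<close> can be split off, which is what makes the
  convexity strong.\<close>

lemma convex_ln_quotient:
  fixes k t :: real
  assumes k: "0 < k" and t: "0 < t" "t < 1"
  shows "\<exists>e>0. convex_on {0<..<1 / sqrt k}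
    (\<lambda>x. (t - ln (1 - t * (k * x\<^sup>2)) / ln (1 - k * x\<^sup>2)) / x\<^sup>2 - e * x\<^sup>2)"
proof -
  obtain c where pos: "\<And>n. 0 < c n" and sums:
    "\<And>v. v \<in> {0<..<1} \<Longrightarrow> (\<lambda>n. c n * v ^ n) sums ((t - ln (1 - t * v) / ln (1 - v)) / v)"
    using ln_quotient_expansion[OF t] by blast
  \<comment> \<open>The coefficients of the even powers once the \<open>x\<^sup>2\<close> term is taken out.\<close>
  define d where "d n = (if n = 1 then 0 else c n * k ^ Suc n)" for n
  have "convex_on {0<..<1 / sqrt k}
    (\<lambda>x. (t - ln (1 - t * (k * x\<^sup>2)) / ln (1 - k * x\<^sup>2)) / x\<^sup>2 - (c 1 * k\<^sup>2) * x\<^sup>2)"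
  proof (rule convex_on_even_power_series)
    show "0 \<le> d n" for n
      using pos[of n] k by (simp add: d_def)
    fix x assume "x \<in> {0<..<1 / sqrt k}"
    then have "k * x\<^sup>2 \<in> {0<..<1}"
      by (rule mult_square_in_unit_interval[OF k])
    from sums_mult[OF sums[OF this], of k]
    have "(\<lambda>n. k * (c n * (k * x\<^sup>2) ^ n)) sums
        ((t - ln (1 - t * (k * x\<^sup>2)) / ln (1 - k * x\<^sup>2)) / x\<^sup>2)"
      using k by simp
    also have "(\<lambda>n. k * (c n * (k * x\<^sup>2) ^ n)) = (\<lambda>n. c n * k ^ Suc n * x ^ (2 * n))"
      by (simp only: power_mult_distrib power_mult power_Suc mult.assoc mult.left_commute)
    finally have *: "(\<lambda>n. c n * k ^ Suc n * x ^ (2 * n)) sums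
        ((t - ln (1 - t * (k * x\<^sup>2)) / ln (1 - k * x\<^sup>2)) / x\<^sup>2)" .
    have "(\<lambda>n. if n = 1 then c 1 * k\<^sup>2 * x\<^sup>2 else 0) sums (c 1 * k\<^sup>2 * x\<^sup>2)"
      by (rule sums_single)
    from sums_diff[OF * this]
    show "(\<lambda>n. d n * x ^ (2 * n)) sums
        ((t - ln (1 - t * (k * x\<^sup>2)) / ln (1 - k * x\<^sup>2)) / x\<^sup>2 - (c 1 * k\<^sup>2) * x\<^sup>2)"
      by (rule sums_cong[THEN iffD1, rotated]) (auto simp: d_def power2_eq_square)
  qed simp
  then show ?thesis
    using pos[of 1] k by (intro exI[of _ "c 1 * k\<^sup>2"]) auto
qed

section \<open>The logarithm of the cardinal sine\<close>

lemma ln_sinc_sums: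
  assumes x: "0 < x" "x < pi"
  shows "(\<lambda>m. ln (1 - (x / (pi * real (Suc m)))\<^sup>2)) sums ln (sin x / x)"
proof -
  have pos: "0 < 1 - (x / (pi * real (Suc m)))\<^sup>2" for m
  proof -
    have "x * 1 < pi * real (Suc m)"
      using x by (intro mult_less_le_imp_less) auto
    then have "x / (pi * real (Suc m)) < 1"
      by simp
    then have "(x / (pi * real (Suc m)))\<^sup>2 < 1"
      using x by (intro power_less_one_iff[THEN iffD2]) auto
    then show ?thesis by simp
  qed
  have ln_prod_eq: "ln (\<Prod>m<n. 1 - (x / (pi * real (Suc m)))\<^sup>2) =
      (\<Sum>m<n. ln (1 - (x / (pi * real (Suc m)))\<^sup>2))" for n
    by (rule ln_prod) (use less_imp_neq[OF pos] in auto)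
  have "(\<lambda>n. \<Prod>m<n. 1 - (x / (pi * real (Suc m)))\<^sup>2) \<longlonglongrightarrow> sin x / x"
  proof -
    have "(\<lambda>n. \<Prod>m=1..n. 1 - (x / pi)\<^sup>2 / (real m)\<^sup>2) \<longlonglongrightarrow> sin (pi * (x / pi)) / (pi * (x / pi))"
      using x by (intro sin_product_formula_real') simp
    moreover have "(\<Prod>m=1..n. 1 - (x / pi)\<^sup>2 / (real m)\<^sup>2) = (\<Prod>m<n. 1 - (x / (pi * real (Suc m)))\<^sup>2)" for n
      by (rule prod.reindex_bij_witness[of _ Suc "\<lambda>m. m - 1"])
        (auto simp: power_divide power_mult_distrib)
    ultimately show ?thesis by simp
  qed
  moreover have "sin x / x \<noteq> 0"
    using x sin_gt_zero[of x] by simp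
  ultimately have "(\<lambda>n. ln (\<Prod>m<n. 1 - (x / (pi * real (Suc m)))\<^sup>2)) \<longlonglongrightarrow> ln (sin x / x)"
    by (rule tendsto_ln)
  then show ?thesis
    unfolding sums_def ln_prod_eq .
qed

text \<open>By the product formula for the sine the function is the sum of the functions in
  \<open>convex_ln_quotient\<close> with \<open>t = 1 / (\<pi> m)\<^sup>2 / k\<close>; the constants \<open>t\<close> sum to \<open>1 / (6 k)\<close> because
  \<open>1 / m\<^sup>2\<close> sums to \<open>\<pi>\<^sup>2 / 6\<close>. The factor with \<open>m = 1\<close> alone supplies the modulus \<open>e\<close>. The
  assumption on \<open>k\<close> ensures both \<open>t < 1\<close> for all \<open>m\<close> and \<open>1 / sqrt k < \<pi>\<close>.\<close>

lemma convex_ln_sinc_quotient: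
  fixes k :: real
  assumes k: "1 / pi\<^sup>2 < k"
  shows "\<exists>e>0. convex_on {0<..<1 / sqrt k}
    (\<lambda>x. (1 / (6 * k) - ln (sin x / x) / ln (1 - k * x\<^sup>2)) / x\<^sup>2 - e * x\<^sup>2)"
proof -
  have k_pos: "0 < k"
    using k by (smt (verit) zero_less_divide_iff zero_less_power pi_gt_zero)
  define t where "t m = 1 / (pi * real (Suc m))\<^sup>2 / k" for m
  define F where "F m x = (t m - ln (1 - t m * (k * x\<^sup>2)) / ln (1 - k * x\<^sup>2)) / x\<^sup>2" for m x
  let ?I = "{0<..<1 / sqrt k}"
  have t: "0 < t m" "t m < 1" for m
  proof -
    have "1 / (pi * real (Suc m))\<^sup>2 \<le> 1 / pi\<^sup>2"
      by (intro divide_left_mono power_mono) auto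
    with k have "1 / (pi * real (Suc m))\<^sup>2 < k" by linarith
    then show "t m < 1"
      unfolding t_def using k_pos by (subst divide_less_eq_1_pos)
    show "0 < t m" using k_pos by (simp add: t_def)
  qed
  have conv: "\<exists>e>0. convex_on ?I (\<lambda>x. F m x - e * x\<^sup>2)" for m
    unfolding F_def by (rule convex_ln_quotient[OF k_pos t])
  obtain e where e: "e > 0" "convex_on ?I (\<lambda>x. F 0 x - e * x\<^sup>2)"
    using conv by blast
  have convF: "convex_on ?I (F m)" for m
  proof -
    obtain e' where e': "e' > 0" "convex_on ?I (\<lambda>x. F m x - e' * x\<^sup>2)"
      using conv by blast
    have "convex_on ?I (\<lambda>x. e' * x\<^sup>2)"
      using e'(1) by (intro convex_on_cmul convex_on_subset[OF convex_power2]) auto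
    from convex_on_add[OF e'(2) this] show ?thesis by simp
  qed
  have "convex_on ?I (\<lambda>x. (1 / (6 * k) - ln (sin x / x) / ln (1 - k * x\<^sup>2)) / x\<^sup>2 - e * x\<^sup>2)"
  proof (rule convex_on_pointwise_limit)
    show "convex_on ?I (\<lambda>x. (\<Sum>m<Suc N. F m x) - e * x\<^sup>2)" for N
    proof (induction N)
      case 0
      then show ?case using e by simp
    next
      case (Suc N)
      from convex_on_add[OF this convF[of "Suc N"]] show ?case
        by (simp add: algebra_simps)
    qed
    fix x assume "x \<in> ?I"
    then have x: "0 < x" "x < 1 / sqrt k" by auto
    have "sqrt (1 / pi\<^sup>2) < sqrt k"
      using k by (rule real_sqrt_less_mono)
    then have "1 / pi < sqrt k"
      by (simp add: real_sqrt_divide)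
    then have "1 / sqrt k < pi"
      using k_pos by (simp add: field_simps)
    then have "x < pi" using x by simp
    have "(\<lambda>m. (1 / (pi\<^sup>2 * k)) * (1 / (1 + real m)\<^sup>2)) sums ((1 / (pi\<^sup>2 * k)) * (pi\<^sup>2 / 6))"
      by (intro sums_mult) (use inverse_squares_sums in simp)
    also have "(\<lambda>m. (1 / (pi\<^sup>2 * k)) * (1 / (1 + real m)\<^sup>2)) = t"
      unfolding t_def power_mult_distrib by (auto simp: fun_eq_iff)
    also have "(1 / (pi\<^sup>2 * k)) * (pi\<^sup>2 / 6) = 1 / (6 * k)"
      by simp
    finally have "t sums (1 / (6 * k))" .
    moreover have "t m * (k * x\<^sup>2) = (x / (pi * real (Suc m)))\<^sup>2" for m
      using k_pos by (simp add: t_def power_divide)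
    then have "(\<lambda>m. ln (1 - t m * (k * x\<^sup>2))) sums ln (sin x / x)"
      using ln_sinc_sums[OF x(1) \<open>x < pi\<close>] by simp
    ultimately have "(\<lambda>m. F m x) sums
        ((1 / (6 * k) - ln (sin x / x) / ln (1 - k * x\<^sup>2)) / x\<^sup>2)"
      unfolding F_def by (intro sums_divide sums_diff)
    then have "(\<lambda>N. \<Sum>m<N. F m x) \<longlonglongrightarrow>
        (1 / (6 * k) - ln (sin x / x) / ln (1 - k * x\<^sup>2)) / x\<^sup>2"
      by (simp add: sums_def)
    then show "(\<lambda>N. (\<Sum>m<Suc N. F m x) - e * x\<^sup>2) \<longlonglongrightarrow>
        (1 / (6 * k) - ln (sin x / x) / ln (1 - k * x\<^sup>2)) / x\<^sup>2 - e * x\<^sup>2"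
      by (intro tendsto_diff tendsto_const LIMSEQ_Suc)
  qed
  then show ?thesis using e(1) by blast
qed

text \<open>The convex function \<open>f x - e x\<^sup>2\<close> lies above its tangent at \<open>c\<close>; rearranged, this is
  \<open>f x \<ge> e (x - c)\<^sup>2\<close>.\<close>

lemma strongly_convex_pos_off_critical_zero:
  fixes f :: "real \<Rightarrow> real"
  assumes conv: "convex_on A (\<lambda>x. f x - e * x\<^sup>2)" and e: "0 < e"
    and A: "connected A" "c \<in> interior A" "x \<in> A" "x \<noteq> c"
    and zero: "f c = 0" "(f has_real_derivative 0) (at c)"
  shows "0 < f x"
proof -
  have "((\<lambda>x. f x - e * x\<^sup>2) has_real_derivative - (2 * e * c)) (at c within A)"
    by (rule has_field_derivative_at_within)
      (use zero(2) in \<open>auto intro!: derivative_eq_intros\<close>)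
  from convex_on_imp_above_tangent[OF conv A(1,2,3) this]
  have "e * (x - c)\<^sup>2 \<le> f x"
    using zero(1) by (simp add: power2_eq_square algebra_simps)
  moreover have "0 < e * (x - c)\<^sup>2"
    using e A(4) by simp
  ultimately show ?thesis by linarith
qed

section \<open>Determination of the exponent\<close>

text \<open>L'Hospital's rule, applied twice. It turns the three conditions at \<open>0\<close> into the single
  statement that \<open>f\<close> vanishes to second order, which can be compared with an asymptotic
  expansion of \<open>f\<close> itself rather than of its second derivative.\<close>

lemma tendsto_0_divide_square:
  fixes f :: "real \<Rightarrow> real"
  assumes lim: "(f \<longlongrightarrow> 0) (at_right 0)" "(deriv f \<longlongrightarrow> 0) (at_right 0)"
      "(deriv (deriv f) \<longlongrightarrow> 0) (at_right 0)"
    and diff: "\<forall>\<^sub>F x in at_right 0. f differentiable at x"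
      "\<forall>\<^sub>F x in at_right 0. deriv f differentiable at x"
  shows "((\<lambda>x. f x / x\<^sup>2) \<longlongrightarrow> 0) (at_right 0)"
proof (rule lhopital_right_0)
  have pos: "\<forall>\<^sub>F x::real in at_right 0. 0 < x"
    by (rule eventually_at_right_less)
  show "((\<lambda>x. deriv f x / (2 * x)) \<longlongrightarrow> 0) (at_right 0)"
  proof (rule lhopital_right_0)
    show "((\<lambda>x. deriv (deriv f) x / 2) \<longlongrightarrow> 0) (at_right 0)"
      using tendsto_divide[OF lim(3) tendsto_const[of 2]] by simp
    show "((\<lambda>x::real. 2 * x) \<longlongrightarrow> 0) (at_right 0)"
      by real_asymp
    show "\<forall>\<^sub>F x in at_right 0. (deriv f has_real_derivative deriv (deriv f) x) (at x)"
      using diff(2) by eventually_elim (simp add: DERIV_deriv_iff_real_differentiable)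
    show "\<forall>\<^sub>F x::real in at_right 0. 2 * x \<noteq> 0"
      using pos by eventually_elim simp
    show "\<forall>\<^sub>F x::real in at_right 0. ((\<lambda>x. 2 * x) has_real_derivative 2) (at x)"
      by (intro always_eventually allI) (auto intro!: derivative_eq_intros)
  qed (use lim in auto)
  show "((\<lambda>x::real. x\<^sup>2) \<longlongrightarrow> 0) (at_right 0)"
    by real_asymp
  show "\<forall>\<^sub>F x in at_right 0. (f has_real_derivative deriv f x) (at x)"
    using diff(1) by eventually_elim (simp add: DERIV_deriv_iff_real_differentiable)
  show "\<forall>\<^sub>F x::real in at_right 0. x\<^sup>2 \<noteq> 0" "\<forall>\<^sub>F x::real in at_right 0. 2 * x \<noteq> 0"
    using pos by (eventually_elim, simp)+
  show "\<forall>\<^sub>F x::real in at_right 0. ((\<lambda>x. x\<^sup>2) has_real_derivative 2 * x) (at x)"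
    by (intro always_eventually allI) (auto intro!: derivative_eq_intros)
qed (rule lim(1))

definition \<kappa> :: real where
  "\<kappa> = 4 * (pi - 2) / pi ^ 3"

lemma f2_altdef:
  "f2 \<alpha> \<beta> \<delta> x = (1 - \<kappa> * x\<^sup>2) powr (\<alpha> * x ^ 3 + \<beta> * x\<^sup>2 + \<delta>) - sin x / x"
  by (simp add: f2_def \<kappa>_def)

lemma \<kappa>_gt: "1 / pi\<^sup>2 < \<kappa>"
  using pi_gt3 by (simp add: \<kappa>_def field_simps power2_eq_square power3_eq_cube)

lemma \<kappa>_pos: "0 < \<kappa>"
  using pi_gt3 by (simp add: \<kappa>_def)

lemma \<kappa>_half_pi: "1 - \<kappa> * (pi / 2)\<^sup>2 = 2 / pi"
  by (simp add: \<kappa>_def field_simps power2_eq_square power3_eq_cube)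

text \<open>The function \<open>f2\<close> is smooth up to \<open>1 / sqrt \<kappa>\<close>. Working on this larger interval makes
  \<open>\<pi> / 2\<close> an interior point, so that the tangent there bounds a convex function from below.\<close>

lemma half_pi_in_interval: "pi / 2 \<in> {0<..<1 / sqrt \<kappa>}"
proof -
  have "\<kappa> * (pi / 2)\<^sup>2 < 1"
    using \<kappa>_half_pi by (smt (verit) pi_gt_zero zero_less_divide_iff)
  moreover have "(sqrt \<kappa> * (pi / 2))\<^sup>2 = \<kappa> * (pi / 2)\<^sup>2"
    unfolding power_mult_distrib using \<kappa>_pos by simp
  ultimately have "(sqrt \<kappa> * (pi / 2))\<^sup>2 < 1\<^sup>2"
    by simp
  then have "sqrt \<kappa> * (pi / 2) < 1"
    by (rule power2_less_imp_less) simp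
  then show ?thesis
    using \<kappa>_pos by (simp add: field_simps)
qed

lemma f2_base_pos: "x \<in> {0<..<1 / sqrt \<kappa>} \<Longrightarrow> 0 < 1 - \<kappa> * x\<^sup>2"
  using mult_square_in_unit_interval[OF \<kappa>_pos] by auto

definition f2_deriv :: "real \<Rightarrow> real \<Rightarrow> real \<Rightarrow> real \<Rightarrow> real" where
  "f2_deriv \<alpha> \<beta> \<delta> x =
    (1 - \<kappa> * x\<^sup>2) powr (\<alpha> * x ^ 3 + \<beta> * x\<^sup>2 + \<delta>) *
      ((3 * \<alpha> * x\<^sup>2 + 2 * \<beta> * x) * ln (1 - \<kappa> * x\<^sup>2)
        + (- 2 * \<kappa> * x) * (\<alpha> * x ^ 3 + \<beta> * x\<^sup>2 + \<delta>) / (1 - \<kappa> * x\<^sup>2))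
    - (x * cos x - sin x) / x\<^sup>2"

lemma f2_power_has_derivative:
  assumes "x \<in> {0<..<1 / sqrt \<kappa>}"
  shows "((\<lambda>x. (1 - \<kappa> * x\<^sup>2) powr (\<alpha> * x ^ 3 + \<beta> * x\<^sup>2 + \<delta>)) has_real_derivative
    (1 - \<kappa> * x\<^sup>2) powr (\<alpha> * x ^ 3 + \<beta> * x\<^sup>2 + \<delta>) *
      ((3 * \<alpha> * x\<^sup>2 + 2 * \<beta> * x) * ln (1 - \<kappa> * x\<^sup>2)
        + (- 2 * \<kappa> * x) * (\<alpha> * x ^ 3 + \<beta> * x\<^sup>2 + \<delta>) / (1 - \<kappa> * x\<^sup>2))) (at x)"
  by (rule DERIV_powr[where g = "\<lambda>x. 1 - \<kappa> * x\<^sup>2", OF _ f2_base_pos[OF assms]])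
    (auto intro!: derivative_eq_intros)

lemma f2_has_derivative:
  assumes "x \<in> {0<..<1 / sqrt \<kappa>}"
  shows "(f2 \<alpha> \<beta> \<delta> has_real_derivative f2_deriv \<alpha> \<beta> \<delta> x) (at x)"
  unfolding f2_altdef[abs_def] f2_deriv_def
proof (rule DERIV_diff[OF f2_power_has_derivative[OF assms]])
  show "((\<lambda>x. sin x / x) has_real_derivative (x * cos x - sin x) / x\<^sup>2) (at x)"
    using assms by (auto intro!: derivative_eq_intros simp: power2_eq_square mult.commute)
qed

text \<open>L'Hospital's rule at \<open>0\<close> presupposes that \<open>f2\<close> has a second derivative near \<open>0\<close>.\<close>

lemma f2_deriv_differentiable:
  assumes "x \<in> {0<..<1 / sqrt \<kappa>}"
  shows "f2_deriv \<alpha> \<beta> \<delta> differentiable at x"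
proof -
  have pos: "0 < 1 - \<kappa> * x\<^sup>2"
    by (rule f2_base_pos[OF assms])
  have power: "(\<lambda>x. (1 - \<kappa> * x\<^sup>2) powr (\<alpha> * x ^ 3 + \<beta> * x\<^sup>2 + \<delta>)) differentiable at x"
    using f2_power_has_derivative[OF assms] unfolding real_differentiable_def by blast
  have "((\<lambda>x. ln (1 - \<kappa> * x\<^sup>2)) has_real_derivative (- 2 * \<kappa> * x) / (1 - \<kappa> * x\<^sup>2)) (at x)"
    using pos by (auto intro!: derivative_eq_intros)
  then have ln: "(\<lambda>x. ln (1 - \<kappa> * x\<^sup>2)) differentiable at x"
    unfolding real_differentiable_def by blast
  have trig: "sin differentiable at x" "cos differentiable at x"
    unfolding real_differentiable_def using DERIV_sin DERIV_cos by blast+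
  show ?thesis
    unfolding f2_deriv_def[abs_def]
    using pos assms
    by (intro differentiable_diff differentiable_mult differentiable_add differentiable_divide
        differentiable_power differentiable_ident differentiable_const power ln trig) auto
qed

text \<open>Near \<open>0\<close> the power is \<open>1 - \<kappa> \<delta> x\<^sup>2 + o(x\<^sup>2)\<close> and \<open>sin x / x\<close> is \<open>1 - x\<^sup>2 / 6 + o(x\<^sup>2)\<close>, so
  \<open>f2 x / x\<^sup>2\<close> tends to \<open>1 / 6 - \<kappa> \<delta>\<close>.\<close>

lemma f2_flat_at_0:
  assumes "(f2 \<alpha> \<beta> \<delta> \<longlongrightarrow> 0) (at_right 0)"
    and "(deriv (f2 \<alpha> \<beta> \<delta>) \<longlongrightarrow> 0) (at_right 0)"
    and "(deriv (deriv (f2 \<alpha> \<beta> \<delta>)) \<longlongrightarrow> 0) (at_right 0)"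
  shows "\<kappa> * \<delta> = 1 / 6"
proof -
  let ?I = "{0<..<1 / sqrt \<kappa>}"
  have ev: "\<forall>\<^sub>F x in at_right 0. x \<in> ?I"
    using \<kappa>_pos by (intro eventually_at_right_real) simp
  have deriv_eq: "deriv (f2 \<alpha> \<beta> \<delta>) x = f2_deriv \<alpha> \<beta> \<delta> x" if "x \<in> ?I" for x
    using f2_has_derivative[OF that] by (rule DERIV_imp_deriv)
  have "((\<lambda>x. f2 \<alpha> \<beta> \<delta> x / x\<^sup>2) \<longlongrightarrow> 0) (at_right 0)"
  proof (rule tendsto_0_divide_square[OF assms])
    show "\<forall>\<^sub>F x in at_right 0. f2 \<alpha> \<beta> \<delta> differentiable at x"
      using ev unfolding real_differentiable_def
      by eventually_elim (blast intro: f2_has_derivative)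
    show "\<forall>\<^sub>F x in at_right 0. deriv (f2 \<alpha> \<beta> \<delta>) differentiable at x"
      using ev
    proof eventually_elim
      fix x assume x: "x \<in> ?I"
      obtain D where "(f2_deriv \<alpha> \<beta> \<delta> has_real_derivative D) (at x)"
        using f2_deriv_differentiable[OF x, of \<alpha> \<beta> \<delta>] unfolding real_differentiable_def by blast
      then have "(deriv (f2 \<alpha> \<beta> \<delta>) has_real_derivative D) (at x)"
        by (rule has_field_derivative_transform_within_open[OF _ _ x]) (auto simp: deriv_eq)
      then show "deriv (f2 \<alpha> \<beta> \<delta>) differentiable at x"
        by (auto simp: real_differentiable_def)
    qed
  qed
  moreover have "((\<lambda>x. f2 \<alpha> \<beta> \<delta> x / x\<^sup>2) \<longlongrightarrow> 1 / 6 - \<kappa> * \<delta>) (at_right 0)"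
    unfolding f2_altdef by real_asymp
  ultimately have "0 = 1 / 6 - \<kappa> * \<delta>"
    by (intro tendsto_unique[of "at_right (0::real)"]) auto
  then show ?thesis by simp
qed

text \<open>At \<open>\<pi> / 2\<close> both the base \<open>1 - \<kappa> x\<^sup>2\<close> and \<open>sin x / x\<close> equal \<open>2 / \<pi>\<close>; this is the point of the
  choice of \<open>\<kappa>\<close>.\<close>

lemma f2_exponent_at_half_pi:
  assumes "f2 \<alpha> \<beta> \<delta> (pi / 2) = 0"
  shows "\<alpha> * (pi / 2) ^ 3 + \<beta> * (pi / 2)\<^sup>2 + \<delta> = 1"
proof -
  have "(2 / pi) powr (\<alpha> * (pi / 2) ^ 3 + \<beta> * (pi / 2)\<^sup>2 + \<delta>) = (2 / pi) powr 1"
    using assms unfolding f2_altdef \<kappa>_half_pi by simp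
  then show ?thesis
    using pi_gt3 by (subst (asm) powr_inj) auto
qed

text \<open>The left derivative of \<open>f2\<close> at \<open>\<pi> / 2\<close> is the two-sided one given by the formula.\<close>

lemma f2_deriv_half_pi_eq_0:
  assumes "(f2 \<alpha> \<beta> \<delta> has_real_derivative 0) (at_left (pi / 2))"
  shows "f2_deriv \<alpha> \<beta> \<delta> (pi / 2) = 0"
proof -
  have "(f2 \<alpha> \<beta> \<delta> has_real_derivative f2_deriv \<alpha> \<beta> \<delta> (pi / 2)) (at_left (pi / 2))"
    by (rule has_field_derivative_at_within[OF f2_has_derivative[OF half_pi_in_interval]])
  with assms show ?thesis
    unfolding has_field_derivative_iff
    using tendsto_unique[OF trivial_limit_at_left_real] by blast
qed

lemma cubic_coefficients_from_end_data:
  fixes a b d h v s :: real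
  assumes v: "a * h ^ 3 + b * h\<^sup>2 + d = v" and s: "3 * a * h\<^sup>2 + 2 * b * h = s" and h: "h \<noteq> 0"
  shows "a = (s * h - 2 * (v - d)) / h ^ 3" "b = (3 * (v - d) - s * h) / h\<^sup>2"
  using h unfolding v[symmetric] s[symmetric]
  by (simp_all add: field_simps power2_eq_square power3_eq_cube)

lemma f2_exponent_slope_at_half_pi:
  assumes p: "\<alpha> * (pi / 2) ^ 3 + \<beta> * (pi / 2)\<^sup>2 + \<delta> = 1"
    and d: "f2_deriv \<alpha> \<beta> \<delta> (pi / 2) = 0"
  shows "(3 * \<alpha> * (pi / 2)\<^sup>2 + 2 * \<beta> * (pi / 2)) * ln (pi / 2) = - 2 * (pi - 3) / pi"
proof -
  have ln: "ln (2 / pi) = - ln (pi / 2)"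
    by (simp add: ln_div)
  let ?S = "(3 * \<alpha> * (pi / 2)\<^sup>2 + 2 * \<beta> * (pi / 2)) * ln (pi / 2)"
  have base: "- 2 * \<kappa> * (pi / 2) / (2 / pi) = - 2 * (pi - 2) / pi"
    by (simp add: \<kappa>_def field_simps power2_eq_square power3_eq_cube)
  have sinc: "1 / (pi / 2)\<^sup>2 = 2 / pi * (2 / pi)"
    by (simp add: field_simps power2_eq_square)
  have "2 / pi * (- ?S + - 2 * \<kappa> * (pi / 2) / (2 / pi)) + 1 / (pi / 2)\<^sup>2 = 0"
    using d unfolding f2_deriv_def p \<kappa>_half_pi ln by simp
  then have "2 / pi * (- ?S + - 2 * (pi - 2) / pi + 2 / pi) = 0"
    unfolding base sinc by (simp only: distrib_left)
  then have "- ?S + - 2 * (pi - 2) / pi + 2 / pi = 0"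
    by (simp only: mult_eq_0_iff) simp
  then show ?thesis
    by (simp add: diff_divide_distrib)
qed

section \<open>The sign of the difference\<close>

text \<open>The function \<open>W = (p - R) / x\<^sup>2\<close> is strongly convex by \<open>convex_ln_sinc_quotient\<close>, an affine
  function being added. Since \<open>p ln (1 - \<kappa> x\<^sup>2) = ln (f2 x + sin x / x)\<close>, the double zero of
  \<open>f2\<close> at \<open>\<pi> / 2\<close> is inherited by \<open>W\<close>.\<close>

lemma f2_neg:
  assumes \<delta>: "\<kappa> * \<delta> = 1 / 6"
    and zero: "f2 \<alpha> \<beta> \<delta> (pi / 2) = 0"
    and flat: "f2_deriv \<alpha> \<beta> \<delta> (pi / 2) = 0"
    and x: "x \<in> {0<..<pi / 2}"
  shows "f2 \<alpha> \<beta> \<delta> x < 0"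
proof -
  let ?I = "{0<..<1 / sqrt \<kappa>}"
  define p where "p x = \<alpha> * x ^ 3 + \<beta> * x\<^sup>2 + \<delta>" for x
  \<comment> \<open>In this form convexity is visible; \<open>W_exponents\<close> is the form that decides the sign of \<open>f2\<close>.\<close>
  define W where "W x = \<beta> + \<alpha> * x
    + (1 / (6 * \<kappa>) - ln (sin x / x) / ln (1 - \<kappa> * x\<^sup>2)) / x\<^sup>2" for x
  have xI: "x \<in> ?I"
    using x half_pi_in_interval by auto
  obtain e where e: "0 < e" "convex_on ?I
      (\<lambda>x. (1 / (6 * \<kappa>) - ln (sin x / x) / ln (1 - \<kappa> * x\<^sup>2)) / x\<^sup>2 - e * x\<^sup>2)"
    using convex_ln_sinc_quotient[OF \<kappa>_gt] by blast
  have \<delta>': "\<delta> = 1 / (6 * \<kappa>)"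
    using \<delta> \<kappa>_pos by (simp add: field_simps)
  have "convex_on ?I (\<lambda>x. \<beta> + \<alpha> * x)"
    by (rule convex_on_realI[where f' = "\<lambda>_. \<alpha>"]) (auto intro!: derivative_eq_intros)
  from convex_on_add[OF this e(2)]
  have conv: "convex_on ?I (\<lambda>x. W x - e * x\<^sup>2)"
    by (simp add: W_def add_diff_eq)
  have W_exponents: "W y = (p y - ln (sin y / y) / ln (1 - \<kappa> * y\<^sup>2)) / y\<^sup>2" if "y \<in> ?I" for y
    using that unfolding W_def p_def \<delta>'[symmetric]
    by (simp add: add_divide_distrib diff_divide_distrib power2_eq_square power3_eq_cube)
  have ln_base: "ln (1 - \<kappa> * y\<^sup>2) < 0" if "y \<in> ?I" for y
    using mult_square_in_unit_interval[OF \<kappa>_pos that] by simp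
  \<comment> \<open>In this form the double zero at \<open>\<pi> / 2\<close> can be read off from that of \<open>f2\<close>.\<close>
  have W_eq: "W y = (ln (f2 \<alpha> \<beta> \<delta> y + sin y / y) - ln (sin y / y)) / (ln (1 - \<kappa> * y\<^sup>2) * y\<^sup>2)"
    if "y \<in> ?I" for y
  proof -
    have "ln (f2 \<alpha> \<beta> \<delta> y + sin y / y) = p y * ln (1 - \<kappa> * y\<^sup>2)"
      using f2_base_pos[OF that] by (simp add: f2_altdef p_def ln_powr)
    then show ?thesis
      using ln_base[OF that] by (simp add: W_exponents[OF that] diff_divide_distrib)
  qed
  have W_zero: "W (pi / 2) = 0"
    using zero by (simp add: W_eq[OF half_pi_in_interval])
  have "(W has_real_derivative 0) (at (pi / 2))"
  proof (rule has_field_derivative_transform_within_open[OF _ _ half_pi_in_interval])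
    let ?s' = "- 1 / (pi / 2)\<^sup>2"
    have s: "((\<lambda>y. sin y / y) has_real_derivative ?s') (at (pi / 2))"
      by (auto intro!: derivative_eq_intros simp: power2_eq_square)
    have f: "(f2 \<alpha> \<beta> \<delta> has_real_derivative 0) (at (pi / 2))"
      using f2_has_derivative[OF half_pi_in_interval] flat by metis
    have num: "((\<lambda>y. ln (f2 \<alpha> \<beta> \<delta> y + sin y / y) - ln (sin y / y)) has_real_derivative 0) (at (pi / 2))"
      using zero by (auto intro!: derivative_eq_intros f s)
    have den: "((\<lambda>y. ln (1 - \<kappa> * y\<^sup>2) * y\<^sup>2) has_real_derivative
        (- 2 * \<kappa> * (pi / 2)) / (2 / pi) * (pi / 2)\<^sup>2 + ln (2 / pi) * (2 * (pi / 2))) (at (pi / 2))"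
      using \<kappa>_half_pi by (auto intro!: derivative_eq_intros)
    have "ln (1 - \<kappa> * (pi / 2)\<^sup>2) * (pi / 2)\<^sup>2 \<noteq> 0"
      using ln_base[OF half_pi_in_interval] by simp
    from DERIV_divide[OF num den this]
    show "((\<lambda>y. (ln (f2 \<alpha> \<beta> \<delta> y + sin y / y) - ln (sin y / y)) / (ln (1 - \<kappa> * y\<^sup>2) * y\<^sup>2))
        has_real_derivative 0) (at (pi / 2))"
      using zero by simp
  qed (auto simp: W_eq)
  then have "0 < W x"
    using strongly_convex_pos_off_critical_zero[OF conv e(1) _ _ xI _ W_zero] half_pi_in_interval x
    by (auto simp: interior_open)
  then have "ln (sin x / x) / ln (1 - \<kappa> * x\<^sup>2) < p x"
    using x by (simp add: W_exponents[OF xI] zero_less_divide_iff)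
  then have "p x * ln (1 - \<kappa> * x\<^sup>2) < ln (sin x / x)"
    using ln_base[OF xI] by (simp add: field_simps)
  moreover have "0 < sin x / x"
    using x sin_gt_zero[of x] by auto
  ultimately have "exp (p x * ln (1 - \<kappa> * x\<^sup>2)) < sin x / x"
    by (metis exp_less_mono exp_ln)
  then show ?thesis
    using f2_base_pos[OF xI] by (simp add: f2_altdef powr_def p_def)
qed

theorem theorem2:
  fixes \<alpha>\<^sub>2 \<beta>\<^sub>2 \<delta>\<^sub>2 :: real
  assumes "(f2 \<alpha>\<^sub>2 \<beta>\<^sub>2 \<delta>\<^sub>2 \<longlongrightarrow> 0) (at_right 0)"
    and "(deriv (f2 \<alpha>\<^sub>2 \<beta>\<^sub>2 \<delta>\<^sub>2) \<longlongrightarrow> 0) (at_right 0)"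
    and "(deriv (deriv (f2 \<alpha>\<^sub>2 \<beta>\<^sub>2 \<delta>\<^sub>2)) \<longlongrightarrow> 0) (at_right 0)"
    and "f2 \<alpha>\<^sub>2 \<beta>\<^sub>2 \<delta>\<^sub>2 (pi / 2) = 0"
    and "(f2 \<alpha>\<^sub>2 \<beta>\<^sub>2 \<delta>\<^sub>2 has_real_derivative 0) (at_left (pi / 2))"
  shows "\<alpha>\<^sub>2 = - (2 / 3) * ((12 * (pi - 2) * (pi - 3) - (48 - 24 * pi + pi ^ 3) * ln (pi / 2))
                  / (pi ^ 3 * (pi - 2) * ln (pi / 2)))
       \<and> \<beta>\<^sub>2 = (8 * (pi - 2) * (pi - 3) - (48 - 24 * pi + pi ^ 3) * ln (pi / 2))
                  / (2 * pi\<^sup>2 * (pi - 2) * ln (pi / 2))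
       \<and> \<delta>\<^sub>2 = pi ^ 3 / (24 * (pi - 2))
       \<and> (\<forall>x \<in> {0<..<pi / 2}. f2 \<alpha>\<^sub>2 \<beta>\<^sub>2 \<delta>\<^sub>2 x < 0)"
  proof -
  let ?L = "ln (pi / 2)"
  have L: "0 < ?L"
    using pi_gt3 by simp
  have \<kappa>\<delta>: "\<kappa> * \<delta>\<^sub>2 = 1 / 6"
    by (rule f2_flat_at_0[OF assms(1-3)])
  have p: "\<alpha>\<^sub>2 * (pi / 2) ^ 3 + \<beta>\<^sub>2 * (pi / 2)\<^sup>2 + \<delta>\<^sub>2 = 1"
    by (rule f2_exponent_at_half_pi[OF assms(4)])
  have flat: "f2_deriv \<alpha>\<^sub>2 \<beta>\<^sub>2 \<delta>\<^sub>2 (pi / 2) = 0"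
    by (rule f2_deriv_half_pi_eq_0[OF assms(5)])
  define D where "D = - 2 * (pi - 3) / (pi * ?L)"
  have D: "3 * \<alpha>\<^sub>2 * (pi / 2)\<^sup>2 + 2 * \<beta>\<^sub>2 * (pi / 2) = D"
    using f2_exponent_slope_at_half_pi[OF p flat] L by (simp add: D_def field_simps)
  have \<delta>: "\<delta>\<^sub>2 = pi ^ 3 / (24 * (pi - 2))"
    using \<kappa>\<delta> pi_gt3 by (simp add: \<kappa>_def field_simps)
  have \<alpha>: "\<alpha>\<^sub>2 = (D * (pi / 2) - 2 * (1 - \<delta>\<^sub>2)) / (pi / 2) ^ 3"
    and \<beta>: "\<beta>\<^sub>2 = (3 * (1 - \<delta>\<^sub>2) - D * (pi / 2)) / (pi / 2)\<^sup>2"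
    using cubic_coefficients_from_end_data[OF p D] by simp_all
  have nz: "pi \<noteq> 0" "pi - 2 \<noteq> 0" "?L \<noteq> 0"
    using pi_gt3 L by auto
  have "\<alpha>\<^sub>2 = - (2 / 3) * ((12 * (pi - 2) * (pi - 3) - (48 - 24 * pi + pi ^ 3) * ?L)
                  / (pi ^ 3 * (pi - 2) * ?L))"
    unfolding \<alpha> \<delta> D_def using nz by (simp add: divide_simps) (simp add: algebra_simps power2_eq_square power3_eq_cube)
  moreover have "\<beta>\<^sub>2 = (8 * (pi - 2) * (pi - 3) - (48 - 24 * pi + pi ^ 3) * ?L)
                  / (2 * pi\<^sup>2 * (pi - 2) * ?L)"
    unfolding \<beta> \<delta> D_def using nz by (simp add: divide_simps) (simp add: algebra_simps power2_eq_square power3_eq_cube)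
  moreover have "\<forall>x \<in> {0<..<pi / 2}. f2 \<alpha>\<^sub>2 \<beta>\<^sub>2 \<delta>\<^sub>2 x < 0"
    using f2_neg[OF \<kappa>\<delta> assms(4) flat] by blast
  ultimately show ?thesis
    using \<delta> by blast
qed

end
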